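(* No tax-based incentive mechanism can guarantee social optimality, voluntary participation and weak budget balance simultaneously in all instances of security games. Precisely: there exists a security game with users $1,\dots,N$ and cost functions $g_i(\mathbf{x})=f_i(\mathbf{x})+h_i(x_i)$, which possesses a socially optimal profile and, for each user $i$, an exit equilibrium for user $i$, such that for every socially optimal profile $\mathbf{x}^*$, every choice of exit equilibria $\hat{\mathbf{x}}^1,\dots,\hat{\mathbf{x}}^N$ (with $\hat{\mathbf{x}}^i$ an exit equilibrium for user $i$) and every tax profile $(t_1,\dots,t_N)\in\mathbb{R}^N$, the voluntary participation conditions $$g_i(\mathbf{x}^* )+t_i\le g_i(\hat{\mathbf{x}}^i)\qquad\text{for all } i=1,\dots,N$$ and the weak budget balance condition $\sum_{i=1}^N t_i\ge 0$ do not both hold.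
   Context: A security game consists of $N$ users; user $i$ chooses an investment $x_i\in\mathbb{R}_{\ge 0}$, and $\mathbf{x}=(x_1,\dots,x_N)$. User $i$ has an investment cost function $h_i:\mathbb{R}_{\ge0}\to\mathbb{R}_{\ge0}$ that is continuous, increasing and convex, and a risk function $f_i:\mathbb{R}_{\ge0}^N\to\mathbb{R}_{\ge0}$ that is continuous, and non-increasing and strictly convex in all arguments $x_j$. The cost of user $i$ is $g_i(\mathbf{x})=f_i(\mathbf{x})+h_i(x_i)$. Each user wants to minimize its cost; if user $i$ is assigned a tax $t_i\in\mathbb{R}$ (positive = payment, negative = reward), its total cost is $g_i(\mathbf{x})+t_i$. A socially optimal profile is a minimizer $\mathbf{x}^*$ of $\sum_i g_i(\mathbf{x})$ over $\mathbf{x}\in\mathbb{R}_{\ge0}^N$. A tax-based mechanism achieving social optimality implements a socially optimal profile $\mathbf{x}^*$ and assigns taxes $t_1,\dots,t_N$. An exit equilibrium for user $i$ (the outcome when user $i$ unilaterally opts out of the mechanism) is a profile $\hat{\mathbf{x}}^i\in\mathbb{R}_{\ge0}^N$ that is a Nash equilibrium of the two-player game between user $i$ and the coalition of the other $N-1$ users: $\hat x^i_i$ minimizes $x_i\mapsto g_i(\hat{\mathbf{x}}^i_{-i},x_i)$ over $x_i\ge 0$, and $\hat{\mathbf{x}}^i_{-i}$ minimizes $\mathbf{x}_{-i}\mapsto\sum_{j\ne i}g_j(\mathbf{x}_{-i},\hat x^i_i)$ over $\mathbf{x}_{-i}\in\mathbb{R}_{\ge0}^{N-1}$. *)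

theory Defs
  imports "HOL-Analysis.Analysis"
begin

definition strictly_convex_on :: "'a::real_vector set \<Rightarrow> ('a \<Rightarrow> real) \<Rightarrow> bool" where
  "strictly_convex_on S f \<longleftrightarrow> convex S \<and>
     (\<forall>x\<in>S. \<forall>y\<in>S. \<forall>u>0. \<forall>v>0. x \<noteq> y \<longrightarrow> u + v = 1 \<longrightarrow>
        f (u *\<^sub>R x + v *\<^sub>R y) < u * f x + v * f y)"

(* Nonnegative investment profiles of a set I of users. The functions are extensional
   (undefined outside I), so for finite I this is the nonnegative orthant of dimension card I,
   and continuous_on refers to its usual (product) topology. *)
definition profiles :: "nat set \<Rightarrow> (nat \<Rightarrow> real) set" where
  "profiles I = I \<rightarrow>\<^sub>E {0..}"

(* Monotonicity and strict convexity of a risk function are required in each argument x_j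
   separately, with the other arguments fixed, whereas continuity is joint. "Increasing" for the
   investment cost is strict. *)
locale security_game =
  fixes N :: nat
    and f :: "nat \<Rightarrow> (nat \<Rightarrow> real) \<Rightarrow> real"
    and h :: "nat \<Rightarrow> real \<Rightarrow> real"
  assumes h_nonneg: "\<And>i y. i \<in> {1..N} \<Longrightarrow> y \<ge> 0 \<Longrightarrow> h i y \<ge> 0"
    and h_continuous: "\<And>i. i \<in> {1..N} \<Longrightarrow> continuous_on {0..} (h i)"
    and h_increasing: "\<And>i. i \<in> {1..N} \<Longrightarrow> strict_mono_on {0..} (h i)"
    and h_convex: "\<And>i. i \<in> {1..N} \<Longrightarrow> convex_on {0..} (h i)"
    and f_nonneg: "\<And>i x. i \<in> {1..N} \<Longrightarrow> x \<in> profiles {1..N} \<Longrightarrow> f i x \<ge> 0"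
    and f_continuous: "\<And>i. i \<in> {1..N} \<Longrightarrow> continuous_on (profiles {1..N}) (f i)"
    and f_nonincreasing: "\<And>i j x. i \<in> {1..N} \<Longrightarrow> j \<in> {1..N} \<Longrightarrow> x \<in> profiles {1..N} \<Longrightarrow>
          antimono_on {0..} (\<lambda>y. f i (x(j := y)))"
    and f_strictly_convex: "\<And>i j x. i \<in> {1..N} \<Longrightarrow> j \<in> {1..N} \<Longrightarrow> x \<in> profiles {1..N} \<Longrightarrow>
          strictly_convex_on {0..} (\<lambda>y. f i (x(j := y)))"

definition user_cost ::
  "(nat \<Rightarrow> (nat \<Rightarrow> real) \<Rightarrow> real) \<Rightarrow> (nat \<Rightarrow> real \<Rightarrow> real) \<Rightarrow> nat \<Rightarrow> (nat \<Rightarrow> real) \<Rightarrow> real" where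
  "user_cost f h i x = f i x + h i (x i)"

definition socially_optimal :: "nat \<Rightarrow> (nat \<Rightarrow> (nat \<Rightarrow> real) \<Rightarrow> real) \<Rightarrow> (nat \<Rightarrow> real) \<Rightarrow> bool" where
  "socially_optimal N g x \<longleftrightarrow>
     is_arg_min (\<lambda>y. \<Sum>i=1..N. g i y) (\<lambda>y. y \<in> profiles {1..N}) x"

definition exit_equilibrium ::
  "nat \<Rightarrow> (nat \<Rightarrow> (nat \<Rightarrow> real) \<Rightarrow> real) \<Rightarrow> nat \<Rightarrow> (nat \<Rightarrow> real) \<Rightarrow> bool" where
  "exit_equilibrium N g i x \<longleftrightarrow>
     x \<in> profiles {1..N} \<and>
     is_arg_min (\<lambda>y. g i (x(i := y))) (\<lambda>y. y \<ge> 0) (x i) \<and>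
     is_arg_min (\<lambda>z. \<Sum>j\<in>{1..N} - {i}. g j (z(i := x i)))
       (\<lambda>z. z \<in> profiles ({1..N} - {i})) (restrict x ({1..N} - {i}))"

definition voluntary_participation ::
  "nat \<Rightarrow> (nat \<Rightarrow> (nat \<Rightarrow> real) \<Rightarrow> real) \<Rightarrow> (nat \<Rightarrow> real) \<Rightarrow> (nat \<Rightarrow> nat \<Rightarrow> real) \<Rightarrow> (nat \<Rightarrow> real) \<Rightarrow> bool"
  where
  "voluntary_participation N g x xhat t \<longleftrightarrow> (\<forall>i\<in>{1..N}. g i x + t i \<le> g i (xhat i))"

definition weak_budget_balance :: "nat \<Rightarrow> (nat \<Rightarrow> real) \<Rightarrow> bool" where
  "weak_budget_balance N t \<longleftrightarrow> (\<Sum>i=1..N. t i) \<ge> 0"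

end

theory Submission
  imports Defs
begin

text \<open>
  The counterexample is a total-effort game: all users share the risk \<open>1 / (1 + S)\<close>, where \<open>S\<close> is
  the total investment, and investing \<open>y\<close> costs \<open>y\<close>. Since \<open>1 / (1 + y) + y > 1\<close> for \<open>y > 0\<close>, a user
  outside the mechanism never invests, whereas the remaining \<open>N - 1\<close> users still invest a total \<open>T\<close>
  minimizing \<open>(N - 1) / (1 + T) + T\<close>. For \<open>N = 5\<close> this gives \<open>T = 1\<close>, so the free rider pays
  exactly \<open>1/2\<close>. Voluntary participation and weak budget balance together would bound the optimal
  social cost by \<open>5/2\<close>, but \<open>5 / (1 + S) + S > 5/2\<close> for every \<open>S \<ge> 0\<close>.
\<close>

definition effort_risk :: "nat \<Rightarrow> nat \<Rightarrow> (nat \<Rightarrow> real) \<Rightarrow> real" where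
  "effort_risk N i x = 1 / (1 + (\<Sum>j=1..N. x j))"

abbreviation effort_cost :: "nat \<Rightarrow> nat \<Rightarrow> (nat \<Rightarrow> real) \<Rightarrow> real" where
  "effort_cost N \<equiv> user_cost (effort_risk N) (\<lambda>i y. y)"

lemma profiles_nonneg: "x \<in> profiles I \<Longrightarrow> j \<in> I \<Longrightarrow> 0 \<le> x j"
  by (auto simp: profiles_def PiE_def Pi_def)

lemma restrict_mem_profiles: "(\<And>j. j \<in> I \<Longrightarrow> 0 \<le> x j) \<Longrightarrow> restrict x I \<in> profiles I"
  by (auto simp: profiles_def)

lemma profile_sum_nonneg: "x \<in> profiles I \<Longrightarrow> A \<subseteq> I \<Longrightarrow> 0 \<le> sum x A"
  by (meson profiles_nonneg subsetD sum_nonneg)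

lemma sum_upd_diff:
  fixes x :: "'a \<Rightarrow> 'b::comm_monoid_add"
  assumes "finite A" "i \<in> A"
  shows "sum (x(i := y)) A = y + sum x (A - {i})"
proof -
  have "sum (x(i := y)) (A - {i}) = sum x (A - {i})"
    by (rule sum.cong) auto
  then show ?thesis
    using assms by (simp add: sum.remove)
qed

text \<open>Reduces monotonicity and convexity in a single argument to the one-variable function
  \<open>1 / (a + y)\<close>, where \<open>a\<close> collects 1 and the other investments.\<close>

lemma effort_risk_upd:
  "j \<in> {1..N} \<Longrightarrow> effort_risk N i (x(j := y)) = 1 / (1 + sum x ({1..N} - {j}) + y)"
  unfolding effort_risk_def by (subst sum_upd_diff) (auto simp: algebra_simps)

lemma reciprocal_strictly_convex:
  fixes a :: real
  assumes "0 < a"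
  shows "strictly_convex_on {0..} (\<lambda>y. 1 / (a + y))"
  unfolding strictly_convex_on_def
proof (intro conjI ballI allI impI)
  fix x y u v :: real
  assume *: "x \<in> {0..}" "y \<in> {0..}" "0 < u" "0 < v" "x \<noteq> y" "u + v = 1"
  define p q where "p = a + x" and "q = a + y"
  have pq: "0 < p" "0 < q" "p \<noteq> q"
    using * assms by (auto simp: p_def q_def)
  have v: "v = 1 - u"
    using * by simp
  have m: "a + (u *\<^sub>R x + v *\<^sub>R y) = u * p + v * q"
    by (simp add: p_def q_def v algebra_simps)
  have pos: "0 < u * p + v * q"
    using * pq by (simp add: add_pos_pos)
  \<comment> \<open>The convexity gap in closed form: a positive multiple of the square of
    \<open>p - q\<close>, hence positive for distinct points.\<close>
  have "u * (1 / p) + v * (1 / q) - 1 / (u * p + v * q)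
        = u * v * (p - q)\<^sup>2 / (p * q * (u * p + v * q))"
    using pq pos by (simp add: field_simps) (simp add: v power2_eq_square algebra_simps)
  also have "\<dots> > 0"
    using * pq pos by simp
  finally show "1 / (a + (u *\<^sub>R x + v *\<^sub>R y)) < u * (1 / (a + x)) + v * (1 / (a + y))"
    by (simp only: m) (simp add: p_def q_def)
qed simp

lemma security_game_effort: "security_game N (effort_risk N) (\<lambda>i y. y)"
proof
  fix i j x assume "i \<in> {1..N}" and j: "j \<in> {1..N}" and x: "x \<in> profiles {1..N}"
  have a: "0 < 1 + sum x ({1..N} - {j})"
    using profile_sum_nonneg[OF x, of "{1..N} - {j}"] by auto
  show "antimono_on {0..} (\<lambda>y. effort_risk N i (x(j := y)))"
    unfolding effort_risk_upd[OF j] monotone_on_def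
    using a by (auto intro!: divide_left_mono mult_pos_pos)
  show "strictly_convex_on {0..} (\<lambda>y. effort_risk N i (x(j := y)))"
    unfolding effort_risk_upd[OF j] by (rule reciprocal_strictly_convex[OF a])
next
  fix i x assume "x \<in> profiles {1..N}"
  then show "0 \<le> effort_risk N i x"
    using profile_sum_nonneg[of x "{1..N}" "{1..N}"] by (simp add: effort_risk_def)
next
  fix i
  have "1 + sum x {1..N} \<noteq> 0" if "x \<in> profiles {1..N}" for x
    using profile_sum_nonneg[OF that, of "{1..N}"] by simp
  moreover have "continuous_on (profiles {1..N}) (\<lambda>x. x j)" for j
    by (rule continuous_on_subset[OF continuous_on_product_coordinates]) simp
  ultimately show "continuous_on (profiles {1..N}) (effort_risk N i)"
    unfolding effort_risk_def by (intro continuous_intros) auto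
qed (auto simp: strict_mono_on_def convex_on_def)

lemma sum_effort_cost:
  "(\<Sum>i\<in>A. effort_cost N i x) = real (card A) / (1 + (\<Sum>j=1..N. x j)) + sum x A"
  by (simp add: user_cost_def effort_risk_def sum.distrib)

text \<open>The coalition's objective depends on its profile only through the total investment, so
  its best response is a one-variable problem.\<close>

lemma sum_effort_cost_others:
  assumes "i \<in> {1..N}"
  shows "(\<Sum>j\<in>{1..N} - {i}. effort_cost N j (z(i := a)))
       = real (N - 1) / (1 + sum z ({1..N} - {i}) + a) + sum z ({1..N} - {i})"
proof -
  have "sum (z(i := a)) ({1..N} - {i}) = sum z ({1..N} - {i})"
    by (rule sum.cong) auto
  then show ?thesis
    unfolding sum_effort_cost using assms
    by (subst sum_upd_diff) (auto simp: algebra_simps)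
qed

text \<open>AM-GM in the form of a completed square. It is applied to \<open>s\<close> = 1 + total
  investment; the equality case pins down the coalition's total in an exit equilibrium.\<close>

lemma reciprocal_plus_ge:
  fixes c s :: real
  assumes "0 < s" "0 \<le> c"
  shows "2 * c \<le> c\<^sup>2 / s + s" and "c\<^sup>2 / s + s = 2 * c \<longleftrightarrow> s = c"
proof -
  have "c\<^sup>2 / s + s - 2 * c = (s - c)\<^sup>2 / s"
    using assms by (simp add: field_simps power2_eq_square)
  moreover have "(s - c)\<^sup>2 / s \<ge> 0" and "(s - c)\<^sup>2 / s = 0 \<longleftrightarrow> s = c"
    using assms by auto
  ultimately show "2 * c \<le> c\<^sup>2 / s + s" and "c\<^sup>2 / s + s = 2 * c \<longleftrightarrow> s = c"
    by linarith+
qed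

text \<open>Investing \<open>y\<close> lowers the risk by \<open>y\<close> divided by a number
  greater than 1, which is less than the price \<open>y\<close>.\<close>

lemma not_investing_strictly_better:
  fixes a y :: real
  assumes "0 \<le> a" "0 < y"
  shows "1 / (1 + a) < 1 / (1 + a + y) + y"
proof -
  have "1 / (1 + a) - 1 / (1 + a + y) = y / ((1 + a) * (1 + a + y))"
    using assms by (simp add: field_simps)
  also have "\<dots> < y / 1"
  proof (intro divide_strict_left_mono)
    have "1 * 1 < (1 + a) * (1 + a + y)"
      using assms by (intro mult_le_less_imp_less) auto
    then show "1 < (1 + a) * (1 + a + y)" by simp
  qed (use assms in auto)
  finally show ?thesis by simp
qed

lemma effort_cost_self:
  "i \<in> {1..N} \<Longrightarrow> effort_cost N i (x(i := y)) = 1 / (1 + sum x ({1..N} - {i}) + y) + y"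
  by (simp only: user_cost_def effort_risk_upd fun_upd_same)

lemma ex_socially_optimal_effort:
  assumes "1 \<le> N"
  shows "\<exists>x. socially_optimal N (effort_cost N) x"
proof -
  \<comment> \<open>AM-GM with \<open>c = sqrt N\<close> is tight at \<open>s = sqrt N\<close>, i.e.
    at total investment \<open>sqrt N - 1\<close>. How the total is split does not matter, so user 1
    carries all of it.\<close>
  define x where "x = restrict (\<lambda>j. if j = 1 then sqrt N - 1 else 0) {1..N}"
  have x: "x \<in> profiles {1..N}"
    unfolding x_def using assms by (intro restrict_mem_profiles) auto
  have sx: "sum x {1..N} = sqrt N - 1"
    using assms by (simp add: x_def)
  have "(\<Sum>i=1..N. effort_cost N i x) \<le> (\<Sum>i=1..N. effort_cost N i y)"
    if y: "y \<in> profiles {1..N}" for y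
  proof -
    have "0 < 1 + sum y {1..N}"
      using profile_sum_nonneg[OF y, of "{1..N}"] by simp
    from reciprocal_plus_ge(1)[OF this, of "sqrt N"] show ?thesis
      unfolding sum_effort_cost sx by (simp add: real_div_sqrt)
  qed
  then have "socially_optimal N (effort_cost N) x"
    using x by (force simp: socially_optimal_def is_arg_min_def not_less)
  then show ?thesis
    by blast
qed

text \<open>The coalition's optimal total is 1 and its split is irrelevant; user 1 invests it, or
  user 2 when user 1 is the one who exits.\<close>

definition sole_investor :: "nat \<Rightarrow> nat \<Rightarrow> real" where
  "sole_investor i = (\<lambda>j. if j = (if i = 1 then 2 else 1) then 1 else 0)"

lemma sum_sole_investor:
  assumes "i \<in> {1..5}"
  shows "sum (sole_investor i) ({1..5} - {i}) = 1"
  using assms by (auto simp: sole_investor_def)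

lemma exit_equilibrium_sole_investor:
  assumes i: "i \<in> {1..5}"
  shows "exit_equilibrium 5 (effort_cost 5) i (restrict (sole_investor i) {1..5})"
proof -
  define x where "x = restrict (sole_investor i) {1..5}"
  have x: "x \<in> profiles {1..5}"
    unfolding x_def by (rule restrict_mem_profiles) (auto simp: sole_investor_def)
  have xi: "x i = 0"
    using i by (auto simp: x_def sole_investor_def)
  have sx: "sum x ({1..5} - {i}) = 1"
    unfolding x_def sum_sole_investor[OF i, symmetric] by (rule sum.cong) auto
  have sum_restrict: "sum (restrict x ({1..5} - {i})) ({1..5} - {i}) = sum x ({1..5} - {i})"
    by (rule sum.cong) auto
  have "effort_cost 5 i (x(i := 0)) \<le> effort_cost 5 i (x(i := y))" if "0 \<le> y" for y
    unfolding effort_cost_self[OF i] sx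
    using not_investing_strictly_better[of 1 y] that by (cases "y = 0") auto
  moreover have "(\<Sum>j\<in>{1..5} - {i}. effort_cost 5 j ((restrict x ({1..5} - {i}))(i := 0)))
      \<le> (\<Sum>j\<in>{1..5} - {i}. effort_cost 5 j (z(i := 0)))"
    if z: "z \<in> profiles ({1..5} - {i})" for z
    \<comment> \<open>With \<open>s\<close> = 1 + the coalition's total, \<open>4 / s + s\<close> is
      at least 4, so the coalition pays at least 3, which is what \<open>x\<close> attains.\<close>
    using reciprocal_plus_ge(1)[of "1 + sum z ({1..5} - {i})" 2]
      profile_sum_nonneg[OF z order_refl]
    unfolding sum_effort_cost_others[OF i] sum_restrict sx by simp
  moreover have "restrict x ({1..5} - {i}) \<in> profiles ({1..5} - {i})"
    using profiles_nonneg[OF x] by (intro restrict_mem_profiles) auto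
  ultimately show ?thesis
    unfolding exit_equilibrium_def is_arg_min_def x_def[symmetric] xi not_ex
    using x by (auto simp: not_less)
qed

text \<open>Exit equilibria are not unique, since the coalition may split its investment freely, but
  the exiting user's cost depends only on the coalition's total, which is forced to be 1.\<close>

lemma exit_equilibrium_cost:
  assumes i: "i \<in> {1..5}" and "exit_equilibrium 5 (effort_cost 5) i x"
  shows "effort_cost 5 i x = 1 / 2"
proof -
  define T where "T = sum x ({1..5} - {i})"
  have x: "x \<in> profiles {1..5}"
    and self: "\<And>y. 0 \<le> y \<Longrightarrow> effort_cost 5 i (x(i := x i)) \<le> effort_cost 5 i (x(i := y))"
    and others: "\<And>z. z \<in> profiles ({1..5} - {i}) \<Longrightarrow>
      (\<Sum>j\<in>{1..5} - {i}. effort_cost 5 j ((restrict x ({1..5} - {i}))(i := x i)))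
      \<le> (\<Sum>j\<in>{1..5} - {i}. effort_cost 5 j (z(i := x i)))"
    using assms(2) unfolding exit_equilibrium_def is_arg_min_def not_ex by (auto simp: not_less)
  have T: "0 \<le> T"
    unfolding T_def using profile_sum_nonneg[OF x] by auto
  have xi: "x i = 0"
  proof (rule ccontr)
    assume "x i \<noteq> 0"
    then have "0 < x i"
      using profiles_nonneg[OF x i] by simp
    from not_investing_strictly_better[OF T this] self[of 0] show False
      unfolding effort_cost_self[OF i] T_def by simp
  qed
  have "restrict (sole_investor i) ({1..5} - {i}) \<in> profiles ({1..5} - {i})"
    by (rule restrict_mem_profiles) (simp add: sole_investor_def)
  from others[OF this] have "4 / (1 + T) + T \<le> 3"
    unfolding sum_effort_cost_others[OF i] xi
    using sum_sole_investor[OF i] by (simp add: T_def)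
  \<comment> \<open>Adding 1 to both sides turns the bound into the equality case of AM-GM with
    \<open>c = 2\<close>.\<close>
  then have "T = 1"
    using reciprocal_plus_ge[of "1 + T" 2] T by simp
  moreover have "effort_cost 5 i x = 1 / (1 + T)"
    using effort_cost_self[OF i, of x 0] by (simp add: T_def fun_upd_idem[of x, OF xi])
  ultimately show ?thesis
    by simp
qed

lemma social_cost_effort_gt:
  assumes "x \<in> profiles {1..5}"
  shows "5 / 2 < (\<Sum>i=1..5. effort_cost 5 i x)"
proof -
  define s where "s = 1 + sum x {1..5}"
  have s: "0 < s"
    using profile_sum_nonneg[OF assms, of "{1..5}"] by (simp add: s_def)
  \<comment> \<open>Replacing 5 by the perfect square 4 avoids \<open>sqrt 5\<close> and still gives
    a social cost above 3.\<close>
  have "4 \<le> 4 / s + s"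
    using reciprocal_plus_ge(1)[OF s, of 2] by simp
  also have "\<dots> < 5 / s + s"
    using s by (simp add: divide_strict_right_mono)
  finally show ?thesis
    unfolding sum_effort_cost by (simp add: s_def)
qed

theorem mainTheorem1:
  shows "\<exists>N f h. security_game N f h \<and>
    (\<exists>x. socially_optimal N (user_cost f h) x) \<and>
    (\<forall>i\<in>{1..N}. \<exists>x. exit_equilibrium N (user_cost f h) i x) \<and>
    (\<forall>xstar xhat t.
       socially_optimal N (user_cost f h) xstar \<longrightarrow>
       (\<forall>i\<in>{1..N}. exit_equilibrium N (user_cost f h) i (xhat i)) \<longrightarrow>
       \<not> (voluntary_participation N (user_cost f h) xstar xhat t \<and> weak_budget_balance N t))"
proof (intro exI[of _ 5] exI[of _ "effort_risk 5"] exI[of _ "\<lambda>i y. y"] conjI allI impI)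
  show "security_game 5 (effort_risk 5) (\<lambda>i y. y)"
    by (rule security_game_effort)
  show "\<exists>x. socially_optimal 5 (effort_cost 5) x"
    by (rule ex_socially_optimal_effort) simp
  show "\<forall>i\<in>{1..5}. \<exists>x. exit_equilibrium 5 (effort_cost 5) i x"
    using exit_equilibrium_sole_investor by blast
next
  fix xstar :: "nat \<Rightarrow> real" and xhat :: "nat \<Rightarrow> nat \<Rightarrow> real" and t :: "nat \<Rightarrow> real"
  assume opt: "socially_optimal 5 (effort_cost 5) xstar"
    and eq: "\<forall>i\<in>{1..5}. exit_equilibrium 5 (effort_cost 5) i (xhat i)"
  show "\<not> (voluntary_participation 5 (effort_cost 5) xstar xhat t \<and> weak_budget_balance 5 t)"
  proof
    assume "voluntary_participation 5 (effort_cost 5) xstar xhat t \<and> weak_budget_balance 5 t"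
    then have vp: "\<And>i. i \<in> {1..5} \<Longrightarrow> effort_cost 5 i xstar + t i \<le> effort_cost 5 i (xhat i)"
      and bb: "0 \<le> (\<Sum>i=1..5. t i)"
      by (auto simp: voluntary_participation_def weak_budget_balance_def)
    have "5 / 2 < (\<Sum>i=1..5. effort_cost 5 i xstar)"
      using opt by (intro social_cost_effort_gt) (simp add: socially_optimal_def is_arg_min_def)
    also have "\<dots> \<le> (\<Sum>i=1..5. effort_cost 5 i xstar + t i)"
      using bb by (simp only: sum.distrib)
    also have "\<dots> \<le> (\<Sum>i::nat=1..5. 1 / 2)"
      using vp eq exit_equilibrium_cost by (intro sum_mono) metis
    finally show False
      by simp
  qed
qed

end
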